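(* Let $X$ be a finite set with $|X|=n$, and let $a\in\mathcal T_X$ be an idempotent with $r=\operatorname{rank}(a)<n$. Put $A=\operatorname{im}(a)$, $\alpha=\ker(a)$, $P_1=\{f\in\mathcal T_X: fa\mathrel{\mathscr R}f\}$, $P_2=\{f\in\mathcal T_X: af\mathrel{\mathscr L}f\}$ and $P=P_1\cap P_2$. Then: (i) $P_1=\{f\in\mathcal T_X:\operatorname{rank}(fa)=\operatorname{rank}(f)\}=\{f\in\mathcal T_X:\alpha\text{ separates }\operatorname{im}(f)\}$; (ii) $P_2=\{f\in\mathcal T_X:\operatorname{rank}(af)=\operatorname{rank}(f)\}=\{f\in\mathcal T_X:A\text{ saturates }\ker(f)\}$; (iii) $P=\{f\in\mathcal T_X:\operatorname{rank}(afa)=\operatorname{rank}(f)\}=\operatorname{Reg}(\mathcal T_X^a)$ is the set of all regular elements of $\mathcal T_X^a$, and is a subsemigroup of $\mathcal T_X^a$.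
   Context: $\mathcal T_X$ is the full transformation semigroup of all maps $X\to X$ under composition; maps are written on the right ($xf$) and composed from left to right. $\operatorname{im}(f)=\{xf:x\in X\}$, $\ker(f)=\{(x,y):xf=yf\}$, $\operatorname{rank}(f)=|\operatorname{im}(f)|$. $\mathscr R$ and $\mathscr L$ are Green's relations on $\mathcal T_X$. The variant $\mathcal T_X^a$ is the semigroup with underlying set $\mathcal T_X$ and operation $f\star g=fag$. An element $x$ of a semigroup is regular if $x=xyx$ and $y=yxy$ for some $y$; $\operatorname{Reg}(S)$ is the set of regular elements of $S$. For $B\subseteq X$ and an equivalence $\beta$ on $X$: $B$ saturates $\beta$ if each $\beta$-class contains at least one element of $B$; $\beta$ separates $B$ if each $\beta$-class contains at most one element of $B$. *)

theory Defs
  imports "HOL-Library.FuncSet"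
begin

text \<open>
  A semigroup is given by a carrier set and a binary operation on the ambient type, so that the
  two semigroups with carrier \<open>\<T>\<^sub>X\<close> (the full transformation semigroup and its variant) can be
  handled by the same definitions.
\<close>

definition semigroup_on :: "'s set \<Rightarrow> ('s \<Rightarrow> 's \<Rightarrow> 's) \<Rightarrow> bool" where
  "semigroup_on S m \<longleftrightarrow>
     (\<forall>x\<in>S. \<forall>y\<in>S. m x y \<in> S) \<and>
     (\<forall>x\<in>S. \<forall>y\<in>S. \<forall>z\<in>S. m (m x y) z = m x (m y z))"

definition subsemigroup :: "'s set \<Rightarrow> 's set \<Rightarrow> ('s \<Rightarrow> 's \<Rightarrow> 's) \<Rightarrow> bool" where
  "subsemigroup H S m \<longleftrightarrow> H \<noteq> {} \<and> H \<subseteq> S \<and> (\<forall>x\<in>H. \<forall>y\<in>H. m x y \<in> H)"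

text \<open>The principal one-sided ideals \<open>x S\<^sup>1\<close> and \<open>S\<^sup>1 x\<close>; inserting \<open>x\<close> accounts for the
  adjoined identity.\<close>

definition right_ideal :: "'s set \<Rightarrow> ('s \<Rightarrow> 's \<Rightarrow> 's) \<Rightarrow> 's \<Rightarrow> 's set" where
  "right_ideal S m x = insert x {m x s | s. s \<in> S}"

definition left_ideal :: "'s set \<Rightarrow> ('s \<Rightarrow> 's \<Rightarrow> 's) \<Rightarrow> 's \<Rightarrow> 's set" where
  "left_ideal S m x = insert x {m s x | s. s \<in> S}"

definition green_R :: "'s set \<Rightarrow> ('s \<Rightarrow> 's \<Rightarrow> 's) \<Rightarrow> ('s \<times> 's) set" where
  "green_R S m = {(x, y). x \<in> S \<and> y \<in> S \<and> right_ideal S m x = right_ideal S m y}"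

definition green_L :: "'s set \<Rightarrow> ('s \<Rightarrow> 's \<Rightarrow> 's) \<Rightarrow> ('s \<times> 's) set" where
  "green_L S m = {(x, y). x \<in> S \<and> y \<in> S \<and> left_ideal S m x = left_ideal S m y}"

definition Reg :: "'s set \<Rightarrow> ('s \<Rightarrow> 's \<Rightarrow> 's) \<Rightarrow> 's set" where
  "Reg S m = {x \<in> S. \<exists>y\<in>S. x = m (m x y) x \<and> y = m (m y x) y}"

text \<open>Maps \<open>X \<rightarrow> X\<close> are represented extensionally (with value \<open>undefined\<close> outside \<open>X\<close>), so that
  equality of functions is equality of maps on \<open>X\<close>.\<close>

definition trans_maps :: "'a set \<Rightarrow> ('a \<Rightarrow> 'a) set" where
  "trans_maps X = X \<rightarrow>\<^sub>E X"

text \<open>Maps are composed from left to right: \<open>trans_comp X f g\<close> applies \<open>f\<close> first, i.e. it is the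
  product \<open>fg\<close> for maps written on the right.\<close>

definition trans_comp :: "'a set \<Rightarrow> ('a \<Rightarrow> 'a) \<Rightarrow> ('a \<Rightarrow> 'a) \<Rightarrow> ('a \<Rightarrow> 'a)" where
  "trans_comp X f g = compose X g f"

definition variant_comp ::
    "'a set \<Rightarrow> ('a \<Rightarrow> 'a) \<Rightarrow> ('a \<Rightarrow> 'a) \<Rightarrow> ('a \<Rightarrow> 'a) \<Rightarrow> ('a \<Rightarrow> 'a)" where
  "variant_comp X a f g = trans_comp X (trans_comp X f a) g"

definition im :: "'a set \<Rightarrow> ('a \<Rightarrow> 'a) \<Rightarrow> 'a set" where
  "im X f = f ` X"

definition ker :: "'a set \<Rightarrow> ('a \<Rightarrow> 'a) \<Rightarrow> ('a \<times> 'a) set" where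
  "ker X f = {(x, y). x \<in> X \<and> y \<in> X \<and> f x = f y}"

definition rank :: "'a set \<Rightarrow> ('a \<Rightarrow> 'a) \<Rightarrow> nat" where
  "rank X f = card (im X f)"

definition saturates :: "'a set \<Rightarrow> 'a set \<Rightarrow> ('a \<times> 'a) set \<Rightarrow> bool" where
  "saturates X B \<beta> \<longleftrightarrow> (\<forall>C \<in> X // \<beta>. \<exists>x. x \<in> B \<inter> C)"

definition separates :: "'a set \<Rightarrow> ('a \<times> 'a) set \<Rightarrow> 'a set \<Rightarrow> bool" where
  "separates X \<beta> B \<longleftrightarrow> (\<forall>C \<in> X // \<beta>. \<forall>x \<in> B \<inter> C. \<forall>y \<in> B \<inter> C. x = y)"

lemma semigroup_on_trans: "semigroup_on (trans_maps X) (trans_comp X)"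
  unfolding semigroup_on_def trans_maps_def trans_comp_def
  by (auto simp: compose_def fun_eq_iff PiE_iff extensional_def)

lemma semigroup_on_variant:
  assumes "a \<in> trans_maps X"
  shows "semigroup_on (trans_maps X) (variant_comp X a)"
  using semigroup_on_trans[of X] assms unfolding semigroup_on_def variant_comp_def by simp

lemma equiv_ker: "equiv X (ker X f)"
  by (auto simp: equiv_def refl_on_def sym_def trans_def ker_def)

end

theory Submission
  imports Defs
begin

text \<open>
  Everything reduces to two properties of a map \<open>f\<close>: that \<open>a\<close> is injective on \<open>im(f)\<close>, and that
  \<open>f\<close> takes all of its values already on \<open>im(a)\<close>.

  The set \<open>\<T>\<^sub>X\<close> is a monoid, so \<open>fa \<R> f\<close> just says that \<open>f = fas\<close> for some map \<open>s\<close>. Such an \<open>s\<close>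
  exists precisely when \<open>a\<close> can be undone on \<open>im(f)\<close>, that is, when \<open>a\<close> is injective there. Since
  \<open>im(fa)\<close> is the image of the finite set \<open>im(f)\<close> under \<open>a\<close>, this is equivalent to
  \<open>rank(fa) = rank(f)\<close>, and separation of \<open>im(f)\<close> by \<open>ker(a)\<close> is a rewording of it. Dually,
  \<open>af \<L> f\<close> says that \<open>f = saf\<close> for some \<open>s\<close>, and a pointwise choice of preimages produces \<open>s\<close>
  precisely when \<open>f\<close> maps \<open>im(a)\<close> onto \<open>im(f)\<close>. As \<open>im(af)\<close> is a subset of the finite set
  \<open>im(f)\<close>, this is equality of ranks, and saturation of \<open>ker(f)\<close> by \<open>im(a)\<close> is a rewording of it.

  For the intersection, \<open>rank(afa) \<le> rank(af) \<le> rank(f)\<close>, and equality of the outer terms forces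
  both properties. If \<open>f = fas\<close> and \<open>f = taf\<close>, then a generalised inverse \<open>g\<close> of \<open>f\<close> in the
  regular semigroup \<open>\<T>\<^sub>X\<close> gives \<open>f = fgf = fa(sgt)af\<close>, so \<open>f\<close> is regular in the variant; the
  converse is immediate. Finally, both properties are visibly inherited by \<open>fag\<close>, and \<open>a\<close> itself
  has them because it is idempotent.
\<close>

section \<open>Composition of maps\<close>

lemma trans_comp_apply [simp]: "x \<in> X \<Longrightarrow> trans_comp X f g x = g (f x)"
  by (simp add: trans_comp_def compose_def)

lemma trans_maps_apply: "f \<in> trans_maps X \<Longrightarrow> x \<in> X \<Longrightarrow> f x \<in> X"
  by (auto simp: trans_maps_def)

lemma trans_maps_eqI:
  assumes "f \<in> trans_maps X" "g \<in> trans_maps X" "\<And>x. x \<in> X \<Longrightarrow> f x = g x"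
  shows "f = g"
  using assms unfolding trans_maps_def by (rule PiE_ext)

lemma trans_comp_closed:
  "f \<in> trans_maps X \<Longrightarrow> g \<in> trans_maps X \<Longrightarrow> trans_comp X f g \<in> trans_maps X"
  using semigroup_on_trans[of X] by (simp add: semigroup_on_def)

lemma trans_comp_assoc:
  "f \<in> trans_maps X \<Longrightarrow> g \<in> trans_maps X \<Longrightarrow> h \<in> trans_maps X \<Longrightarrow>
    trans_comp X (trans_comp X f g) h = trans_comp X f (trans_comp X g h)"
  using semigroup_on_trans[of X] by (simp add: semigroup_on_def)

lemma im_subset: "f \<in> trans_maps X \<Longrightarrow> im X f \<subseteq> X"
  by (auto simp: im_def trans_maps_apply)

lemma im_trans_comp: "im X (trans_comp X f g) = g ` im X f"
  by (simp add: im_def image_image cong: image_cong_simp)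

lemma restrict_in_trans_maps: "(\<And>x. x \<in> X \<Longrightarrow> h x \<in> X) \<Longrightarrow> restrict h X \<in> trans_maps X"
  by (auto simp: trans_maps_def)

lemma trans_comp_id_right: "f \<in> trans_maps X \<Longrightarrow> trans_comp X f (restrict id X) = f"
  by (rule trans_maps_eqI[where X = X])
    (simp_all add: trans_comp_closed restrict_in_trans_maps trans_maps_apply)

lemma trans_comp_id_left: "f \<in> trans_maps X \<Longrightarrow> trans_comp X (restrict id X) f = f"
  by (rule trans_maps_eqI[where X = X])
    (simp_all add: trans_comp_closed restrict_in_trans_maps)

lemma trans_maps_regular:
  assumes f: "f \<in> trans_maps X"
  obtains g where "g \<in> trans_maps X" "trans_comp X (trans_comp X f g) f = f"
proof
  let ?g = "\<lambda>y. if y \<in> f ` X then inv_into X f y else y"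
  show g: "restrict ?g X \<in> trans_maps X"
    by (rule restrict_in_trans_maps) (auto intro: inv_into_into)
  show "trans_comp X (trans_comp X f (restrict ?g X)) f = f"
    by (rule trans_maps_eqI[where X = X])
      (use f g in \<open>simp_all add: trans_comp_closed trans_maps_apply f_inv_into_f\<close>)
qed

section \<open>Green's relations between an element and its multiples\<close>

lemma green_R_mult_iff:
  assumes S: "semigroup_on S m" and e: "e \<in> S" "\<And>x. x \<in> S \<Longrightarrow> m x e = x"
    and f: "f \<in> S" and a: "a \<in> S"
  shows "(m f a, f) \<in> green_R S m \<longleftrightarrow> (\<exists>s\<in>S. f = m (m f a) s)"
proof
  assume "(m f a, f) \<in> green_R S m"
  then have "f \<in> right_ideal S m (m f a)"
    by (simp add: green_R_def right_ideal_def)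
  then consider "m f a = f" | "\<exists>s\<in>S. f = m (m f a) s"
    by (auto simp: right_ideal_def)
  then show "\<exists>s\<in>S. f = m (m f a) s"
  proof cases
    case 1
    then have "f = m (m f a) e" using e(2)[OF f] by simp
    then show ?thesis using e(1) by blast
  qed
next
  assume "\<exists>s\<in>S. f = m (m f a) s"
  then obtain s where s: "s \<in> S" "f = m (m f a) s" by blast
  have closed: "\<And>x y. x \<in> S \<Longrightarrow> y \<in> S \<Longrightarrow> m x y \<in> S"
    and assoc: "\<And>x y z. x \<in> S \<Longrightarrow> y \<in> S \<Longrightarrow> z \<in> S \<Longrightarrow> m (m x y) z = m x (m y z)"
    using S by (auto simp: semigroup_on_def)
  have "right_ideal S m (m f a) \<subseteq> right_ideal S m f"
    using f a by (auto simp: right_ideal_def assoc intro: closed)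
  moreover have "m f t = m (m f a) (m s t)" if "t \<in> S" for t
    using s assoc[OF closed[OF f a] s(1) that] by simp
  then have "right_ideal S m f \<subseteq> right_ideal S m (m f a)"
    using s by (auto simp: right_ideal_def intro: closed)
  ultimately show "(m f a, f) \<in> green_R S m"
    using f a by (auto simp: green_R_def closed)
qed

lemma green_L_mult_iff:
  assumes S: "semigroup_on S m" and e: "e \<in> S" "\<And>x. x \<in> S \<Longrightarrow> m e x = x"
    and f: "f \<in> S" and a: "a \<in> S"
  shows "(m a f, f) \<in> green_L S m \<longleftrightarrow> (\<exists>s\<in>S. f = m s (m a f))"
proof -
  \<comment> \<open>The opposite semigroup interchanges the two relations.\<close>
  let ?m = "\<lambda>x y. m y x"
  have "semigroup_on S ?m"
    using S by (auto simp: semigroup_on_def)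
  then have "(?m f a, f) \<in> green_R S ?m \<longleftrightarrow> (\<exists>s\<in>S. f = ?m (?m f a) s)"
    by (rule green_R_mult_iff[where e = e]) (use e f a in simp_all)
  then show ?thesis
    by (simp add: green_R_def green_L_def right_ideal_def left_ideal_def)
qed

section \<open>Right multiples: injectivity on the image\<close>

lemma right_factor_iff_inj_on:
  assumes f: "f \<in> trans_maps X" and a: "a \<in> trans_maps X"
  shows "(\<exists>s\<in>trans_maps X. f = trans_comp X (trans_comp X f a) s) \<longleftrightarrow> inj_on a (im X f)"
proof
  assume "\<exists>s\<in>trans_maps X. f = trans_comp X (trans_comp X f a) s"
  then obtain s where s: "f = trans_comp X (trans_comp X f a) s" by blast
  have "s (a (f x)) = f x" if "x \<in> X" for x
    using fun_cong[OF s, of x] that by simp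
  then show "inj_on a (im X f)"
    by (auto simp: im_def intro: inj_on_inverseI[of _ s])
next
  assume inj: "inj_on a (im X f)"
  let ?s = "\<lambda>y. if y \<in> a ` im X f then inv_into (im X f) a y else y"
  have s: "restrict ?s X \<in> trans_maps X"
    using im_subset[OF f] by (intro restrict_in_trans_maps) (auto simp: inj inv_into_f_f)
  moreover have "f = trans_comp X (trans_comp X f a) (restrict ?s X)"
  proof (rule trans_maps_eqI[OF f])
    show "trans_comp X (trans_comp X f a) (restrict ?s X) \<in> trans_maps X"
      using f a s by (simp add: trans_comp_closed)
    show "f x = trans_comp X (trans_comp X f a) (restrict ?s X) x" if "x \<in> X" for x
    proof -
      have "f x \<in> im X f" using that by (simp add: im_def)
      then show ?thesis
        using that f a inj by (simp add: trans_maps_apply)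
    qed
  qed
  ultimately show "\<exists>s\<in>trans_maps X. f = trans_comp X (trans_comp X f a) s"
    by blast
qed

lemma green_R_iff_inj_on:
  assumes f: "f \<in> trans_maps X" and a: "a \<in> trans_maps X"
  shows "(trans_comp X f a, f) \<in> green_R (trans_maps X) (trans_comp X) \<longleftrightarrow> inj_on a (im X f)"
  unfolding right_factor_iff_inj_on[OF f a, symmetric]
  by (rule green_R_mult_iff[OF semigroup_on_trans, where e = "restrict id X"])
    (simp_all add: f a trans_comp_id_right restrict_in_trans_maps)

lemma rank_right_mult_iff_inj_on:
  assumes "finite X"
  shows "rank X (trans_comp X f a) = rank X f \<longleftrightarrow> inj_on a (im X f)"
proof -
  have "finite (im X f)" using assms by (simp add: im_def)
  then show ?thesis
    by (simp add: rank_def im_trans_comp inj_on_iff_eq_card)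
qed

lemma separates_ker_iff_inj_on:
  assumes "B \<subseteq> X"
  shows "separates X (ker X a) B \<longleftrightarrow> inj_on a B"
proof
  assume sep: "separates X (ker X a) B"
  show "inj_on a B"
  proof (rule inj_onI)
    fix x y assume xy: "x \<in> B" "y \<in> B" "a x = a y"
    let ?C = "ker X a `` {x}"
    have "x \<in> X" using xy assms by blast
    then have "?C \<in> X // ker X a" by (rule quotientI)
    moreover have "x \<in> ?C" "y \<in> ?C"
      using xy assms by (auto simp: ker_def)
    ultimately show "x = y"
      using sep xy by (auto simp: separates_def)
  qed
next
  assume "inj_on a B"
  then show "separates X (ker X a) B"
    by (auto simp: separates_def quotient_def ker_def dest: inj_onD)
qed

section \<open>Left multiples: surjectivity onto the image\<close>

lemma left_factor_iff_image_eq: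
  assumes f: "f \<in> trans_maps X" and a: "a \<in> trans_maps X"
  shows "(\<exists>s\<in>trans_maps X. f = trans_comp X s (trans_comp X a f)) \<longleftrightarrow> f ` im X a = im X f"
proof
  assume "\<exists>s\<in>trans_maps X. f = trans_comp X s (trans_comp X a f)"
  then obtain s where s: "s \<in> trans_maps X" "f = trans_comp X s (trans_comp X a f)" by blast
  have "f x \<in> f ` im X a" if "x \<in> X" for x
  proof -
    have "f x = f (a (s x))"
      using fun_cong[OF s(2), of x] that s(1) by (simp add: trans_maps_apply)
    moreover have "a (s x) \<in> im X a"
      using s(1) that by (simp add: im_def trans_maps_apply)
    ultimately show ?thesis by (rule image_eqI)
  qed
  then have "im X f \<subseteq> f ` im X a"
    unfolding im_def[of X f] by blast
  then show "f ` im X a = im X f"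
    using im_subset[OF a] by (auto simp: im_def)
next
  assume eq: "f ` im X a = im X f"
  have "\<exists>y. y \<in> X \<and> f (a y) = f x" if "x \<in> X" for x
  proof -
    have "f x \<in> f ` im X a" unfolding eq using that by (simp add: im_def)
    then show ?thesis by (auto simp: im_def)
  qed
  then obtain h where h: "\<And>x. x \<in> X \<Longrightarrow> h x \<in> X \<and> f (a (h x)) = f x" by metis
  have s: "restrict h X \<in> trans_maps X"
    using h by (intro restrict_in_trans_maps) blast
  moreover have "f = trans_comp X (restrict h X) (trans_comp X a f)"
    by (rule trans_maps_eqI[OF f]) (use f a s h in \<open>simp_all add: trans_comp_closed\<close>)
  ultimately show "\<exists>s\<in>trans_maps X. f = trans_comp X s (trans_comp X a f)"
    by blast
qed

lemma green_L_iff_image_eq: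
  assumes f: "f \<in> trans_maps X" and a: "a \<in> trans_maps X"
  shows "(trans_comp X a f, f) \<in> green_L (trans_maps X) (trans_comp X) \<longleftrightarrow> f ` im X a = im X f"
  unfolding left_factor_iff_image_eq[OF f a, symmetric]
  by (rule green_L_mult_iff[OF semigroup_on_trans, where e = "restrict id X"])
    (simp_all add: f a trans_comp_id_left restrict_in_trans_maps)

lemma image_im_subset: "a \<in> trans_maps X \<Longrightarrow> f ` im X a \<subseteq> im X f"
  by (auto simp: im_def trans_maps_apply)

lemma rank_left_mult_iff_image_eq:
  assumes "finite X" and a: "a \<in> trans_maps X"
  shows "rank X (trans_comp X a f) = rank X f \<longleftrightarrow> f ` im X a = im X f"
proof -
  have "finite (im X f)" using assms(1) by (simp add: im_def)
  then show ?thesis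
    using card_subset_eq[OF _ image_im_subset[OF a]] by (auto simp: rank_def im_trans_comp)
qed

lemma saturates_ker_iff_image_eq:
  assumes a: "a \<in> trans_maps X"
  shows "saturates X (im X a) (ker X f) \<longleftrightarrow> f ` im X a = im X f"
proof -
  have "saturates X (im X a) (ker X f) \<longleftrightarrow> (\<forall>x\<in>X. \<exists>y\<in>im X a. f x = f y)"
    using im_subset[OF a] by (simp add: saturates_def quotient_def ker_def) blast
  also have "\<dots> \<longleftrightarrow> im X f \<subseteq> f ` im X a"
    by (auto simp: im_def)
  also have "\<dots> \<longleftrightarrow> f ` im X a = im X f"
    using image_im_subset[OF a] by blast
  finally show ?thesis .
qed

section \<open>Two-sided multiples and regularity in the variant\<close>

lemma rank_two_sided_mult_iff:
  assumes fin: "finite X" and a: "a \<in> trans_maps X"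
  shows "rank X (trans_comp X (trans_comp X a f) a) = rank X f \<longleftrightarrow>
    inj_on a (im X f) \<and> f ` im X a = im X f"
proof
  have fin_im: "finite (im X h)" for h using fin by (simp add: im_def)
  assume eq: "rank X (trans_comp X (trans_comp X a f) a) = rank X f"
  moreover have "rank X (trans_comp X (trans_comp X a f) a) \<le> rank X (trans_comp X a f)"
    unfolding rank_def im_trans_comp[of _ "trans_comp X a f"] by (rule card_image_le[OF fin_im])
  moreover have "rank X (trans_comp X a f) \<le> rank X f"
    unfolding rank_def im_trans_comp by (rule card_mono[OF fin_im image_im_subset[OF a]])
  ultimately have ranks: "rank X (trans_comp X (trans_comp X a f) a) = rank X (trans_comp X a f)"
    "rank X (trans_comp X a f) = rank X f"
    by simp_all
  have onto: "f ` im X a = im X f"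
    using ranks(2) by (simp add: rank_left_mult_iff_image_eq[OF fin a])
  moreover have "inj_on a (im X (trans_comp X a f))"
    using ranks(1) by (simp add: rank_right_mult_iff_inj_on[OF fin])
  ultimately show "inj_on a (im X f) \<and> f ` im X a = im X f"
    by (simp add: im_trans_comp)
next
  assume "inj_on a (im X f) \<and> f ` im X a = im X f"
  then show "rank X (trans_comp X (trans_comp X a f) a) = rank X f"
    by (simp add: rank_def im_trans_comp card_image)
qed

text \<open>For regularity it is enough to find \<open>y\<close> with \<open>x = xyx\<close>, since \<open>yxy\<close> then satisfies both
  equations.\<close>

lemma Reg_iff:
  assumes S: "semigroup_on S m"
  shows "x \<in> Reg S m \<longleftrightarrow> x \<in> S \<and> (\<exists>y\<in>S. x = m (m x y) x)"
proof
  assume "x \<in> S \<and> (\<exists>y\<in>S. x = m (m x y) x)"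
  then obtain y where x: "x \<in> S" and y: "y \<in> S" and xyx: "x = m (m x y) x" by blast
  have closed: "\<And>u v. u \<in> S \<Longrightarrow> v \<in> S \<Longrightarrow> m u v \<in> S"
    and assoc: "\<And>u v w. u \<in> S \<Longrightarrow> v \<in> S \<Longrightarrow> w \<in> S \<Longrightarrow> m (m u v) w = m u (m v w)"
    using S by (auto simp: semigroup_on_def)
  have xyx': "m x (m y x) = x"
    using xyx[symmetric] x y by (simp add: assoc)
  have absorb: "m x (m y (m x w)) = m x w" if "w \<in> S" for w
    using arg_cong[OF xyx', of "\<lambda>u. m u w"] x y that by (simp add: assoc closed)
  let ?y = "m (m y x) y"
  have "?y \<in> S" "x = m (m x ?y) x" "?y = m (m ?y x) ?y"
    using x y by (simp_all add: assoc closed absorb xyx')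
  then show "x \<in> Reg S m"
    using x unfolding Reg_def by blast
qed (unfold Reg_def, blast)

lemma Reg_variant_iff:
  assumes f: "f \<in> trans_maps X" and a: "a \<in> trans_maps X"
  shows "f \<in> Reg (trans_maps X) (variant_comp X a) \<longleftrightarrow>
    inj_on a (im X f) \<and> f ` im X a = im X f"
proof -
  note simps = trans_comp_assoc trans_comp_closed
  have "f \<in> Reg (trans_maps X) (variant_comp X a) \<longleftrightarrow>
      (\<exists>y\<in>trans_maps X. f = variant_comp X a (variant_comp X a f y) f)"
    using f by (simp add: Reg_iff[OF semigroup_on_variant[OF a]])
  also have "\<dots> \<longleftrightarrow> (\<exists>s\<in>trans_maps X. f = trans_comp X (trans_comp X f a) s) \<and>
      (\<exists>t\<in>trans_maps X. f = trans_comp X t (trans_comp X a f))"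
  proof (intro iffI conjI; (elim bexE conjE)?)
    fix y assume y: "y \<in> trans_maps X" and eq: "f = variant_comp X a (variant_comp X a f y) f"
    have "f = trans_comp X (trans_comp X f a) (trans_comp X y (trans_comp X a f))"
      using eq f a y by (simp add: variant_comp_def simps)
    then show "\<exists>s\<in>trans_maps X. f = trans_comp X (trans_comp X f a) s"
      using f a y by (blast intro: trans_comp_closed)
    have "f = trans_comp X (trans_comp X (trans_comp X f a) y) (trans_comp X a f)"
      using eq f a y by (simp add: variant_comp_def simps)
    then show "\<exists>t\<in>trans_maps X. f = trans_comp X t (trans_comp X a f)"
      using f a y by (blast intro: trans_comp_closed)
  next
    fix s t assume s: "s \<in> trans_maps X" and t: "t \<in> trans_maps X"
      and fs: "f = trans_comp X (trans_comp X f a) s"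
      and ft: "f = trans_comp X t (trans_comp X a f)"
    obtain g where g: "g \<in> trans_maps X" and fgf: "trans_comp X (trans_comp X f g) f = f"
      using trans_maps_regular[OF f] .
    let ?y = "trans_comp X (trans_comp X s g) t"
    have "f = trans_comp X (trans_comp X (trans_comp X (trans_comp X f a) s) g)
        (trans_comp X t (trans_comp X a f))"
      using fgf fs ft by simp
    also have "\<dots> = variant_comp X a (variant_comp X a f ?y) f"
      using f a g s t by (simp add: variant_comp_def simps)
    finally have "f = variant_comp X a (variant_comp X a f ?y) f" .
    then show "\<exists>y\<in>trans_maps X. f = variant_comp X a (variant_comp X a f y) f"
      using s g t by (blast intro: trans_comp_closed)
  qed
  also have "\<dots> \<longleftrightarrow> inj_on a (im X f) \<and> f ` im X a = im X f"
    by (simp only: right_factor_iff_inj_on[OF f a] left_factor_iff_image_eq[OF f a])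
  finally show ?thesis .
qed

lemma subsemigroup_variant:
  assumes a: "a \<in> trans_maps X" and idem: "trans_comp X a a = a"
  shows "subsemigroup {f \<in> trans_maps X. inj_on a (im X f) \<and> f ` im X a = im X f}
    (trans_maps X) (variant_comp X a)" (is "subsemigroup ?P _ _")
  unfolding subsemigroup_def
proof (intro conjI ballI)
  have "a (a x) = a x" if "x \<in> X" for x
    using fun_cong[OF idem, of x] that by simp
  then have "inj_on a (im X a)"
    by (auto simp: im_def inj_on_def)
  moreover have "a ` im X a = im X a"
    using im_trans_comp[of X a a] idem by simp
  ultimately show "?P \<noteq> {}"
    using a by blast
  show "?P \<subseteq> trans_maps X" by blast
  fix f g assume f: "f \<in> ?P" and g: "g \<in> ?P"
  let ?h = "variant_comp X a f g"
  have im_h: "im X ?h = g ` a ` im X f"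
    by (simp add: variant_comp_def im_trans_comp)
  have "im X ?h \<subseteq> im X g"
    unfolding im_h using im_subset[of f X] f a by (auto simp: im_def trans_maps_apply)
  then have "inj_on a (im X ?h)"
    using g by (auto intro: inj_on_subset)
  moreover have "?h ` im X a = g ` a ` f ` im X a"
    using im_subset[OF a] by (force simp: variant_comp_def image_iff)
  then have "?h ` im X a = im X ?h"
    using f by (simp add: im_h)
  ultimately show "?h \<in> ?P"
    using f g a by (simp add: variant_comp_def trans_comp_closed)
qed

section \<open>The characterisations of the two one-sided sets and their intersection\<close>

theorem proposition4p1:
  fixes X :: "'a set" and n r :: nat and a :: "'a \<Rightarrow> 'a"
    and A :: "'a set" and \<alpha> :: "('a \<times> 'a) set"
    and P\<^sub>1 P\<^sub>2 P :: "('a \<Rightarrow> 'a) set"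
  assumes "finite X" and "card X = n"
    and "a \<in> trans_maps X" and "trans_comp X a a = a"
    and "r = rank X a" and "r < n"
    and "A = im X a" and "\<alpha> = ker X a"
    and "P\<^sub>1 = {f \<in> trans_maps X. (trans_comp X f a, f) \<in> green_R (trans_maps X) (trans_comp X)}"
    and "P\<^sub>2 = {f \<in> trans_maps X. (trans_comp X a f, f) \<in> green_L (trans_maps X) (trans_comp X)}"
    and "P = P\<^sub>1 \<inter> P\<^sub>2"
  shows "(P\<^sub>1 = {f \<in> trans_maps X. rank X (trans_comp X f a) = rank X f} \<and>
          P\<^sub>1 = {f \<in> trans_maps X. separates X \<alpha> (im X f)}) \<and>
         (P\<^sub>2 = {f \<in> trans_maps X. rank X (trans_comp X a f) = rank X f} \<and>
          P\<^sub>2 = {f \<in> trans_maps X. saturates X A (ker X f)}) \<and>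
         (P = {f \<in> trans_maps X. rank X (trans_comp X (trans_comp X a f) a) = rank X f} \<and>
          P = Reg (trans_maps X) (variant_comp X a) \<and>
          subsemigroup P (trans_maps X) (variant_comp X a))"
proof -
  note X = assms(1) and a = assms(3)
  have P1: "P\<^sub>1 = {f \<in> trans_maps X. inj_on a (im X f)}"
    unfolding assms(9) using green_R_iff_inj_on[OF _ a] by blast
  have P2: "P\<^sub>2 = {f \<in> trans_maps X. f ` im X a = im X f}"
    unfolding assms(10) using green_L_iff_image_eq[OF _ a] by blast
  have P: "P = {f \<in> trans_maps X. inj_on a (im X f) \<and> f ` im X a = im X f}"
    unfolding assms(11) P1 P2 by blast
  have "P\<^sub>1 = {f \<in> trans_maps X. rank X (trans_comp X f a) = rank X f}"
    unfolding P1 by (simp add: rank_right_mult_iff_inj_on[OF X])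
  moreover have "P\<^sub>1 = {f \<in> trans_maps X. separates X \<alpha> (im X f)}"
    unfolding P1 assms(8) using separates_ker_iff_inj_on[OF im_subset] by blast
  moreover have "P\<^sub>2 = {f \<in> trans_maps X. rank X (trans_comp X a f) = rank X f}"
    unfolding P2 by (simp add: rank_left_mult_iff_image_eq[OF X a])
  moreover have "P\<^sub>2 = {f \<in> trans_maps X. saturates X A (ker X f)}"
    unfolding P2 assms(7) by (simp add: saturates_ker_iff_image_eq[OF a])
  moreover have "P = {f \<in> trans_maps X. rank X (trans_comp X (trans_comp X a f) a) = rank X f}"
    unfolding P by (simp add: rank_two_sided_mult_iff[OF X a])
  moreover have "Reg (trans_maps X) (variant_comp X a) \<subseteq> trans_maps X"
    by (auto simp: Reg_def)
  then have "P = Reg (trans_maps X) (variant_comp X a)"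
    unfolding P using Reg_variant_iff[OF _ a] by blast
  moreover have "subsemigroup P (trans_maps X) (variant_comp X a)"
    unfolding P by (rule subsemigroup_variant[OF a assms(4)])
  ultimately show ?thesis by (intro conjI)
qed

end
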